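(* Let $S$ be the facial monoid with generators $s_i$, $i\in\mathbf{N}$. For every finite set $A\subseteq S$ we have either $|A\smallsetminus s_1A|\geq\tfrac15|A|$ or $|A\smallsetminus s_2A|\geq\tfrac15|A|$.
   Context: $\mathbf{N}=\{1,2,\ldots\}$. The facial monoid is the monoid given by the monoid presentation $S=\langle s_i\ (i\in\mathbf{N}) : s_js_i=s_is_{j+1}\ \forall\,1\leq i\leq j\rangle$. For $s\in S$ and $A\subseteq S$, $sA=\{sa: a\in A\}$. The "either ... or" is inclusive. *)

theory Defs
  imports Complex_Main
begin

text \<open>
  The least monoid congruence on the free monoid \<open>lists X\<close> that contains the relators in \<open>R\<close>.
  It relates only words over \<open>X\<close>, so as a relation on all lists it is a partial equivalence.
\<close>

inductive pres_cong :: "'a set \<Rightarrow> ('a list \<times> 'a list) set \<Rightarrow> 'a list \<Rightarrow> 'a list \<Rightarrow> bool"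
  for X :: "'a set" and R :: "('a list \<times> 'a list) set"
where
  rel: "(u, v) \<in> R \<Longrightarrow> u \<in> lists X \<Longrightarrow> v \<in> lists X \<Longrightarrow> pres_cong X R u v"
| refl: "u \<in> lists X \<Longrightarrow> pres_cong X R u u"
| sym: "pres_cong X R u v \<Longrightarrow> pres_cong X R v u"
| trans: "pres_cong X R u v \<Longrightarrow> pres_cong X R v w \<Longrightarrow> pres_cong X R u w"
| mult: "pres_cong X R u u' \<Longrightarrow> pres_cong X R v v' \<Longrightarrow> pres_cong X R (u @ v) (u' @ v')"

lemma pres_cong_in_lists: "pres_cong X R u v \<Longrightarrow> u \<in> lists X \<and> v \<in> lists X"
  by (induction rule: pres_cong.induct) auto

lemma pres_cong_refl_iff: "pres_cong X R u u \<longleftrightarrow> u \<in> lists X"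
proof
  show "pres_cong X R u u \<Longrightarrow> u \<in> lists X"
    by (drule pres_cong_in_lists) simp
qed (rule pres_cong.refl)

lemma part_equivp_pres_cong: "part_equivp (pres_cong X R)"
proof (rule part_equivpI)
  show "\<exists>x. pres_cong X R x x"
    using pres_cong.refl[of "[]" X R] by auto
  show "symp (pres_cong X R)"
    by (rule sympI) (rule pres_cong.sym)
  show "transp (pres_cong X R)"
    by (rule transpI) (rule pres_cong.trans)
qed

text \<open>The word \<open>[i, j, \<dots>]\<close> stands for \<open>s\<^sub>i s\<^sub>j \<dots>\<close>; the letters are the indices \<open>i \<ge> 1\<close>.\<close>

definition facial_rels :: "(nat list \<times> nat list) set" where
  "facial_rels = {([j, i], [i, j + 1]) | i j. 1 \<le> i \<and> i \<le> j}"

abbreviation facial_cong :: "nat list \<Rightarrow> nat list \<Rightarrow> bool" where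
  "facial_cong \<equiv> pres_cong {1..} facial_rels"

quotient_type facial = "nat list" / partial: facial_cong
  by (rule part_equivp_pres_cong)

instantiation facial :: monoid_mult
begin

lift_definition one_facial :: facial is "[]"
  by (rule pres_cong.refl) simp

lift_definition times_facial :: "facial \<Rightarrow> facial \<Rightarrow> facial" is "(@)"
  by (rule pres_cong.mult)

instance
  by standard (transfer, simp add: pres_cong_refl_iff)+

end

text \<open>The generator \<open>s\<^sub>i\<close>, for \<open>i \<ge> 1\<close>; the value at \<open>0\<close> is unspecified.\<close>

definition facial_gen :: "nat \<Rightarrow> facial" where
  "facial_gen i = abs_facial [i]"

lemma abs_facial_eq_iff:
  assumes "u \<in> lists {1..}" "v \<in> lists {1..}"
  shows "abs_facial u = abs_facial v \<longleftrightarrow> facial_cong u v"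
proof -
  have "facial_cong u u" "facial_cong v v"
    using assms by (auto intro: pres_cong.refl)
  with Quotient3_rel[OF Quotient3_facial, of u v] show ?thesis
    by blast
qed

lemma abs_facial_Nil: "abs_facial [] = 1"
  by (simp add: one_facial.abs_eq)

lemma abs_facial_append:
  assumes "u \<in> lists {1..}" "v \<in> lists {1..}"
  shows "abs_facial (u @ v) = abs_facial u * abs_facial v"
  by (rule times_facial.abs_eq[symmetric]) (use assms in \<open>auto intro: pres_cong.refl\<close>)

lemma facial_gen_rel:
  assumes "1 \<le> i" "i \<le> j"
  shows "facial_gen j * facial_gen i = facial_gen i * facial_gen (j + 1)"
proof -
  have "facial_cong [j, i] [i, j + 1]"
    using assms by (intro pres_cong.rel) (auto simp: facial_rels_def)
  then have "abs_facial ([j] @ [i]) = abs_facial ([i] @ [j + 1])"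
    using assms by (subst abs_facial_eq_iff) auto
  then show ?thesis
    using assms abs_facial_append[of "[j]" "[i]"] abs_facial_append[of "[i]" "[j + 1]"]
    by (simp add: facial_gen_def)
qed

lemma abs_facial_prod_list:
  "u \<in> lists {1..} \<Longrightarrow> abs_facial u = prod_list (map facial_gen u)"
proof (induction u)
  case (Cons i u)
  then show ?case
    using abs_facial_append[of "[i]" u] by (simp add: facial_gen_def)
qed (simp add: abs_facial_Nil)

lemma facial_generated: "\<exists>u \<in> lists {1..}. x = prod_list (map facial_gen u)"
proof -
  obtain u where "facial_cong u u" "x = abs_facial u"
    using Quotient3_abs_rep[OF Quotient3_facial] Quotient3_rep_reflp[OF Quotient3_facial] by metis
  then have "u \<in> lists {1..}" "x = prod_list (map facial_gen u)"
    by (simp_all only: pres_cong_refl_iff abs_facial_prod_list)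
  then show ?thesis
    by (rule bexI[rotated])
qed

end

(* Write f and g for left multiplication by s_1 and s_2. Since s_1 s_1 = s_1 s_2, the points f z
   and g z have the same image under f, and they are always distinct. If A is almost contained in
   f A and in g A, then f z and g z lie in A for most z in A, and the points g z obtained in this
   way fill most of A. So f merges most points of A with another point of A and hence |f A| is
   at most about |A| / 2, which contradicts that f A covers most of A.

   To see that s_1 z and s_2 z differ, send s_i to the coface map that skips the value i. This is
   an anti-homomorphism into the injective maps, so it is enough that the coface maps of 1 and 2
   differ. *)

theory Submission
  imports Defs
begin

text \<open>The partner \<open>u\<close> of a point of \<open>W\<close> again lies in
  \<open>W\<close>, so every fibre of \<open>f\<close> on \<open>W\<close> has at least two points
  and \<open>W\<close> has at most \<open>card W / 2\<close> images; \<open>A - W\<close> has at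
  most \<open>card (A - W)\<close>.\<close>

lemma card_image_two_to_one:
  assumes "finite A" and W: "W = {w \<in> A. \<exists>u \<in> A. u \<noteq> w \<and> f u = f w}"
  shows "2 * card (f ` A) + card W \<le> 2 * card A"
proof -
  have fin: "finite W" and sub: "W \<subseteq> A"
    using assms by auto
  have two: "2 \<le> card {w \<in> W. f w = y}" if y: "y \<in> f ` W" for y
  proof -
    obtain w u where "w \<in> A" "u \<in> A" "u \<noteq> w" "f u = f w" "y = f w"
      using y W by auto
    then have "{w, u} \<subseteq> {w \<in> W. f w = y}"
      using W by fastforce
    moreover have "card {w, u} = 2"
      using \<open>u \<noteq> w\<close> by simp
    ultimately show ?thesis
      using card_mono[of "{w \<in> W. f w = y}" "{w, u}"] fin by simp
  qed
  have "2 * card (f ` W) = (\<Sum>y \<in> f ` W. 2)"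
    by simp
  also have "\<dots> \<le> (\<Sum>y \<in> f ` W. card {w \<in> W. f w = y})"
    by (intro sum_mono two)
  also have "\<dots> = card W"
    using sum.image_gen[OF fin, of "\<lambda>_. 1 :: nat" f] by simp
  finally have "2 * card (f ` W) \<le> card W" .
  moreover have "card (f ` A) \<le> card (f ` W) + card (A - W)"
  proof -
    have "f ` A = f ` W \<union> f ` (A - W)"
      using sub by auto
    then show ?thesis
      using card_Un_le[of "f ` W" "f ` (A - W)"] card_image_le[of "A - W" f] \<open>finite A\<close> by simp
  qed
  moreover have "card (A - W) + card W = card A"
    using card_Diff_subset[OF fin sub] card_mono[OF \<open>finite A\<close> sub] by simp
  ultimately show ?thesis
    by linarith
qed

lemma card_le_card_Diff_image_plus:
  assumes "finite A"
  shows "card A \<le> card (A - f ` A) + card (A \<inter> f ` A)"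
  using card_Un_le[of "A - f ` A" "A \<inter> f ` A"] by (simp add: Un_Diff_Int)

text \<open>Put a = |A - f A| and b = |A - g A|. Then |B| \<le> a, hence |W| \<ge> |A| - b - a,
  while |f A| \<ge> |A| - a. Inserting both into 2|f A| + |W| \<le> 2|A| gives |A| \<le> 3a +
  b.\<close>

lemma card_le_Diff_images:
  assumes fin: "finite A"
    and same: "\<And>z. f (f z) = f (g z)" and diff: "\<And>z. f z \<noteq> g z"
  shows "card A \<le> 3 * card (A - f ` A) + card (A - g ` A)"
proof -
  define W where "W = {w \<in> A. \<exists>u \<in> A. u \<noteq> w \<and> f u = f w}"
  define B where "B = {z \<in> A. f z \<notin> A}"
  have finB: "finite B" and finW: "finite W"
    using fin by (auto simp: B_def W_def)
  have f_A: "card A \<le> card (A - f ` A) + card (A \<inter> f ` A)"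
    and g_A: "card A \<le> card (A - g ` A) + card (A \<inter> g ` A)"
    using card_le_card_Diff_image_plus[OF fin] by blast+
  have "A \<inter> f ` A \<subseteq> f ` (A - B)"
    by (auto simp: B_def)
  then have "card (A \<inter> f ` A) \<le> card (A - B)"
    using fin by (meson card_image_le card_mono finite_Diff finite_imageI le_trans)
  moreover have "card (A - B) + card B = card A"
    using card_Diff_subset[OF finB, of A] card_mono[OF fin, of B] by (auto simp: B_def)
  ultimately have B: "card B \<le> card (A - f ` A)"
    using f_A by linarith
  \<comment> \<open>For \<open>z\<close> outside \<open>B\<close>, the point \<open>f z\<close> of
    \<open>A\<close> is the partner that puts \<open>g z\<close> into \<open>W\<close>.\<close>
  have "A \<inter> g ` A \<subseteq> W \<union> g ` B"
  proof
    fix w assume "w \<in> A \<inter> g ` A"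
    then obtain z where z: "z \<in> A" "g z \<in> A" "w = g z"
      by auto
    show "w \<in> W \<union> g ` B"
      using z same[of z] diff[of z] by (cases "f z \<in> A") (auto simp: W_def B_def)
  qed
  then have "card (A \<inter> g ` A) \<le> card (W \<union> g ` B)"
    using finB finW by (intro card_mono) auto
  also have "\<dots> \<le> card W + card B"
    using card_Un_le[of W "g ` B"] card_image_le[OF finB, of g] by linarith
  finally have "card (A \<inter> g ` A) \<le> card W + card B" .
  moreover have "card (A \<inter> f ` A) \<le> card (f ` A)"
    using fin by (intro card_mono) auto
  moreover have "2 * card (f ` A) + card W \<le> 2 * card A"
    using fin W_def by (rule card_image_two_to_one)
  ultimately show ?thesis
    using f_A g_A B by linarith
qed

definition coface :: "nat \<Rightarrow> nat \<Rightarrow> nat" where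
  "coface i n = (if n < i then n else n + 1)"

lemma coface_comp: "i \<le> j \<Longrightarrow> coface i \<circ> coface j = coface (j + 1) \<circ> coface i"
  by (auto simp: coface_def fun_eq_iff)

lemma inj_fold_coface: "inj (fold coface u)"
proof (induction u)
  case (Cons i u)
  moreover have "inj (coface i)"
    by (rule injI) (auto simp: coface_def split: if_splits)
  ultimately show ?case
    by (auto simp: comp_def intro: injI dest: injD)
qed (simp add: id_def)

text \<open>\<open>fold\<close> applies the first letter first, so \<open>[j, i]\<close> becomes
  \<open>coface i \<circ> coface j\<close>, and \<open>coface_comp\<close> is exactly the defining
  relation.\<close>

lemma fold_coface_cong: "facial_cong u v \<Longrightarrow> fold coface u = fold coface v"
proof (induction rule: pres_cong.induct)
  case (rel u v)
  then show ?case
    by (auto simp: facial_rels_def coface_comp simp del: Suc_eq_plus1 One_nat_def)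
qed simp_all

lemma facial_gen_1_mult_neq: "facial_gen 1 * z \<noteq> facial_gen 2 * z"
proof
  assume eq: "facial_gen 1 * z = facial_gen 2 * z"
  obtain u where u: "u \<in> lists {1..}" and "z = abs_facial u"
    using facial_generated[of z] abs_facial_prod_list by metis
  then have "facial_gen i * z = abs_facial (i # u)" if "1 \<le> i" for i
    using that abs_facial_append[of "[i]" u] by (simp add: facial_gen_def)
  then have "abs_facial (1 # u) = abs_facial (2 # u)"
    using eq by simp
  then have "facial_cong (1 # u) (2 # u)"
    using u by (subst (asm) abs_facial_eq_iff) auto
  \<comment> \<open>The argument 1 separates the two cofaces: they send it to 2 and to 1. The common
    tail \<open>u\<close> acts afterwards and cancels by injectivity.\<close>
  then have "fold coface (1 # u) 1 = fold coface (2 # u) 1"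
    by (simp only: fold_coface_cong)
  then have "coface 1 1 = coface 2 1"
    using inj_fold_coface[of u] by (simp add: inj_eq)
  then show False
    by (simp add: coface_def)
qed

theorem proposition5p3:
  fixes A :: "facial set"
  assumes "finite A"
  shows "real (card (A - (\<lambda>a. facial_gen 1 * a) ` A)) \<ge> 1 / 5 * real (card A) \<or>
         real (card (A - (\<lambda>a. facial_gen 2 * a) ` A)) \<ge> 1 / 5 * real (card A)"
proof -
  have "facial_gen 1 * facial_gen 1 = facial_gen 1 * facial_gen 2"
    using facial_gen_rel[of 1 1] by (simp add: numeral_2_eq_2)
  then have "facial_gen 1 * (facial_gen 1 * z) = facial_gen 1 * (facial_gen 2 * z)" for z
    by (metis mult.assoc)
  then have "card A \<le> 3 * card (A - (\<lambda>a. facial_gen 1 * a) ` A)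
      + card (A - (\<lambda>a. facial_gen 2 * a) ` A)"
    using assms facial_gen_1_mult_neq by (intro card_le_Diff_images)
  \<comment> \<open>If both differences were below |A|/5, the right-hand side would be below
    4|A|/5.\<close>
  then show ?thesis
    by linarith
qed

end
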